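(* Let $\lambda\in\mathbb{R}$, and let $M^n\subset\mathbb{R}^{n+1}$ be a smooth, closed, embedded $\lambda$-hypersurface, i.e. $H-\frac{\langle x,\mathbf{n}\rangle}{2}=\lambda$ at every point $x\in M$. If $\lambda\le 0$ and the mean curvature of $M$ satisfies $$0\le H\le \frac{\sqrt{\lambda^2+2}+\lambda}{2}$$ at every point of $M$, then $M$ is a round sphere.
   Context: For a hypersurface $M^n\subset\mathbb{R}^{n+1}$, $x$ denotes the position vector, $\mathbf{n}$ the outer unit normal, and $\langle\cdot,\cdot\rangle$ the Euclidean inner product. The second fundamental form is $A(v,w)=\langle\nabla_v w,\mathbf{n}\rangle$, where $\nabla$ is the Euclidean derivative. The principal curvatures $k_1\le\cdots\le k_n$ are the eigenvalues of $-A$ (with respect to the induced metric), and the mean curvature is $H=-\operatorname{tr}A=k_1+\cdots+k_n$. With this convention the round sphere of radius $R$ with its outer normal has $H=n/R$. For a constant $\lambda\in\mathbb{R}$, $M$ is called a $\lambda$-hypersurface if $H-\frac{\langle x,\mathbf{n}\rangle}{2}=\lambda$ on $M$. "Closed" means compact without boundary. *)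

theory Defs
  imports "HOL-Analysis.Analysis"
begin

primrec Ck_on :: "nat \<Rightarrow> 'a::real_normed_vector set \<Rightarrow> ('a \<Rightarrow> 'b::real_normed_vector) \<Rightarrow> bool"
where
  "Ck_on 0 S f \<longleftrightarrow> continuous_on S f"
| "Ck_on (Suc k) S f \<longleftrightarrow>
     (\<forall>x\<in>S. f differentiable (at x)) \<and>
     (\<forall>v. Ck_on k S (\<lambda>x. frechet_derivative f (at x) v))"

(* Intended for open S only: derivatives are taken in the full space, not within S. *)
definition smooth_on :: "'a::real_normed_vector set \<Rightarrow> ('a \<Rightarrow> 'b::real_normed_vector) \<Rightarrow> bool"
where
  "smooth_on S f \<longleftrightarrow> (\<forall>k. Ck_on k S f)"

(* Embedded codimension-one submanifold without boundary, given by slice charts: near each of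
   its points, a diffeomorphism between open sets of the ambient space flattens M to a
   coordinate hyperplane. *)
definition smooth_embedded_hypersurface :: "'a::euclidean_space set \<Rightarrow> bool"
where
  "smooth_embedded_hypersurface M \<longleftrightarrow>
     (\<forall>p\<in>M. \<exists>(U::'a set) (V::'a set) \<phi> \<psi>. \<exists>b\<in>Basis.
        open U \<and> p \<in> U \<and> open V \<and>
        homeomorphism U V \<phi> \<psi> \<and> smooth_on U \<phi> \<and> smooth_on V \<psi> \<and>
        \<phi> ` (M \<inter> U) = V \<inter> {y. y \<bullet> b = 0})"

definition tangent_space :: "'a::euclidean_space set \<Rightarrow> 'a \<Rightarrow> 'a set"
where
  "tangent_space M p =
     {v. \<exists>\<gamma> \<epsilon>. \<epsilon> > 0 \<and> smooth_on {-\<epsilon><..<\<epsilon>} \<gamma> \<and> \<gamma> ` {-\<epsilon><..<\<epsilon>} \<subseteq> M \<and>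
        \<gamma> 0 = p \<and> (\<gamma> has_vector_derivative v) (at (0::real))}"

(* The sides are taken with respect to the connected component C of M through p, which is
   M itself when M is connected; every component of a compact hypersurface separates space
   into inside C and outside C, so no connectedness of M is needed. *)
definition is_outer_unit_normal :: "'a::euclidean_space set \<Rightarrow> 'a \<Rightarrow> 'a \<Rightarrow> bool"
where
  "is_outer_unit_normal M p \<nu> \<longleftrightarrow>
     norm \<nu> = 1 \<and> (\<forall>v\<in>tangent_space M p. \<nu> \<bullet> v = 0) \<and>
     (let C = connected_component_set M p in
        \<forall>\<^sub>F t in at_right (0::real).
          p + t *\<^sub>R \<nu> \<in> outside C \<and> p - t *\<^sub>R \<nu> \<in> inside C)"

definition tangent_extension :: "'a::euclidean_space set \<Rightarrow> 'a \<Rightarrow> 'a \<Rightarrow> ('a \<Rightarrow> 'a) \<Rightarrow> bool"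
where
  "tangent_extension M p w W \<longleftrightarrow>
     (\<exists>U. open U \<and> p \<in> U \<and> smooth_on U W \<and> (\<forall>q\<in>M \<inter> U. W q \<in> tangent_space M q) \<and> W p = w)"

(* A(v,w) = <nabla_v W, nu>, with w extended to a local field W tangent to M; for tangent
   v, w and normal nu the value does not depend on the choice of W. *)
definition second_fundamental_form ::
  "'a::euclidean_space set \<Rightarrow> 'a \<Rightarrow> 'a \<Rightarrow> 'a \<Rightarrow> 'a \<Rightarrow> real"
where
  "second_fundamental_form M p \<nu> v w =
     frechet_derivative (SOME W. tangent_extension M p w W) (at p) v \<bullet> \<nu>"

definition orthonormal_basis_of :: "'a::euclidean_space set \<Rightarrow> 'a set \<Rightarrow> bool"
where
  "orthonormal_basis_of V B \<longleftrightarrow>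
     pairwise orthogonal B \<and> (\<forall>e\<in>B. norm e = 1) \<and> B \<subseteq> V \<and> span B = V"

(* The trace of a bilinear form on V with respect to the induced inner product; independent
   of the chosen orthonormal basis. *)
definition trace_on :: "'a::euclidean_space set \<Rightarrow> ('a \<Rightarrow> 'a \<Rightarrow> real) \<Rightarrow> real"
where
  "trace_on V A = (\<Sum>e\<in>(SOME B. orthonormal_basis_of V B). A e e)"

definition mean_curvature :: "'a::euclidean_space set \<Rightarrow> 'a \<Rightarrow> 'a \<Rightarrow> real"
where
  "mean_curvature M p \<nu> = - trace_on (tangent_space M p) (second_fundamental_form M p \<nu>)"

definition lambda_hypersurface :: "real \<Rightarrow> 'a::euclidean_space set \<Rightarrow> ('a \<Rightarrow> 'a) \<Rightarrow> bool"
where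
  "lambda_hypersurface l M n \<longleftrightarrow>
     (\<forall>x\<in>M. mean_curvature M x (n x) - (x \<bullet> n x) / 2 = l)"

end

theory Submission
  imports Defs
begin

text \<open>
  Write \<open>\<nu>\<close> for the normal, \<open>H\<close> for the mean curvature and \<open>d\<close> for the dimension of the
  ambient space. The idea is to look at \<open>\<bar>x\<bar>\<^sup>2\<close> on \<open>M\<close>: its Laplacian is
  \<open>2 (d - 1) - 2 H (x \<bullet> \<nu>)\<close>. Since \<open>x \<bullet> \<nu> = 2 (H - \<lambda>)\<close>, the pinching condition on \<open>H\<close>, which
  places \<open>H\<close> between the two roots of \<open>2 H (H - \<lambda>) = 1\<close>, says exactly that \<open>H (x \<bullet> \<nu>) \<le> 1\<close>
  (\<open>curvature_times_support_le_1\<close>). So \<open>\<bar>x\<bar>\<^sup>2\<close> is subharmonic, and strictly so if \<open>d > 2\<close>.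
  
  At a point of \<open>M\<close> farthest from the origin the second derivative test gives
  \<open>H (x \<bullet> \<nu>) \<ge> d - 1\<close> (\<open>farthest_point\<close>). Hence \<open>d = 2\<close>, and only closed plane curves remain.
  There the strong maximum principle becomes a monotonicity statement: along a regular
  parametrization \<open>\<gamma>\<close> the quantity \<open>(\<gamma> \<bullet> \<gamma>') / \<bar>\<gamma>'\<bar>\<close>, the derivative of \<open>\<bar>\<gamma>\<bar>\<^sup>2 / 2\<close> by arc length,
  has derivative \<open>\<bar>\<gamma>'\<bar> (1 - H (\<gamma> \<bullet> \<nu>)) \<ge> 0\<close>. It vanishes at a local maximum of \<open>\<bar>x\<bar>\<close>, so moving away
  from there \<open>\<bar>x\<bar>\<close> cannot decrease and is locally constant (\<open>planar_norm_locally_constant\<close>).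
  An open-closed argument makes it constant on every component of \<open>M\<close>.
  
  On a component of norm \<open>R\<close> the two inequalities give \<open>H (x \<bullet> \<nu>) = 1\<close> with \<open>\<bar>x \<bullet> \<nu>\<bar> = R\<close>, and
  \<open>H \<ge> 0\<close> fixes the sign: \<open>H = 1 / R\<close>. The equation \<open>1 / R - R / 2 = \<lambda>\<close> has at most one positive
  solution, so all components lie on the same circle. A component has a nonempty inside,
  which forces it to be the whole circle (\<open>closed_subset_sphere_eq\<close>), and \<open>M\<close> equals it.
  
  The second fundamental form enters through an arbitrarily chosen tangent extension. The link
  with curves is \<open>second_fundamental_form_eq\<close>: on the diagonal it is the normal component of the
  acceleration of the image of a straight line under the inverse of a slice chart.
\<close>

section \<open>Calculus of smooth maps\<close>

lemma Ck_on_cong: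
  assumes "open S" "\<And>x. x \<in> S \<Longrightarrow> f x = g x" "Ck_on k S f"
  shows "Ck_on k S g"
  using assms(2,3)
proof (induction k arbitrary: f g)
  case 0
  then show ?case using continuous_on_cong[of S S f g] by simp
next
  case (Suc k)
  have der: "(g has_derivative frechet_derivative f (at x)) (at x)" if "x \<in> S" for x
  proof (rule has_derivative_transform_within_open[OF _ assms(1) that Suc.prems(1)])
    show "(f has_derivative frechet_derivative f (at x)) (at x)"
      using Suc.prems(2) that frechet_derivative_works[of f "at x"] by simp
  qed
  have eq: "frechet_derivative g (at x) = frechet_derivative f (at x)" if "x \<in> S" for x
    using frechet_derivative_at[OF der[OF that]] by simp
  have "Ck_on k S (\<lambda>x. frechet_derivative g (at x) v)" for v
    by (rule Suc.IH[of "\<lambda>x. frechet_derivative f (at x) v"]) (use eq Suc.prems in auto)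
  with der show ?case unfolding Ck_on.simps differentiable_def by blast
qed

lemma Ck_on_SucI:
  assumes "open S" "\<And>x. x \<in> S \<Longrightarrow> (f has_derivative f' x) (at x)"
    and "\<And>v. Ck_on k S (\<lambda>x. f' x v)"
  shows "Ck_on (Suc k) S f"
proof -
  have "f' x v = frechet_derivative f (at x) v" if "x \<in> S" for x v
    using frechet_derivative_at[OF assms(2)[OF that]] by simp
  then have "Ck_on k S (\<lambda>x. frechet_derivative f (at x) v)" for v
    by (rule Ck_on_cong[OF assms(1) _ assms(3)])
  with assms(2) show ?thesis unfolding Ck_on.simps differentiable_def by blast
qed

lemma Ck_on_Suc_has_derivative:
  assumes "Ck_on (Suc k) S f" "x \<in> S"
  shows "(f has_derivative frechet_derivative f (at x)) (at x)"
  using assms frechet_derivative_works by auto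

lemma Ck_on_Suc_imp_Ck_on: "Ck_on (Suc k) S f \<Longrightarrow> Ck_on k S f"
proof (induction k arbitrary: f)
  case 0
  then show ?case
    by (auto intro!: continuous_at_imp_continuous_on differentiable_imp_continuous_within)
next
  case (Suc k)
  show ?case
    using Suc.prems Suc.IH unfolding Ck_on.simps(2)[of "Suc k"] Ck_on.simps(2)[of k S f] by blast
qed

lemma Ck_on_const: "open S \<Longrightarrow> Ck_on k S (\<lambda>x. c)"
  by (induction k arbitrary: c)
     (auto intro!: Ck_on_SucI[where f' = "\<lambda>x v. 0"] simp del: Ck_on.simps(2))

lemma Ck_on_bounded_linear: "open S \<Longrightarrow> bounded_linear f \<Longrightarrow> Ck_on k S f"
  by (cases k)
     (auto intro!: Ck_on_SucI[where f' = "\<lambda>x. f"] Ck_on_const bounded_linear_imp_has_derivative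
        simp: linear_continuous_on simp del: Ck_on.simps(2))

lemma Ck_on_add:
  "open S \<Longrightarrow> Ck_on k S f \<Longrightarrow> Ck_on k S g \<Longrightarrow> Ck_on k S (\<lambda>x. f x + g x)"
proof (induction k arbitrary: f g)
  case 0
  then show ?case by (simp add: continuous_on_add)
next
  case (Suc k)
  show ?case
    by (rule Ck_on_SucI[OF Suc.prems(1) has_derivative_add
          [OF Ck_on_Suc_has_derivative Ck_on_Suc_has_derivative]])
       (use Suc in auto)
qed

lemma Ck_on_sum:
  assumes "open S" "\<And>i. i \<in> I \<Longrightarrow> Ck_on k S (f i)"
  shows "Ck_on k S (\<lambda>x. \<Sum>i\<in>I. f i x)"
  using assms(2)
  by (induction I rule: infinite_finite_induct) (auto intro: Ck_on_const Ck_on_add assms(1))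

lemma Ck_on_bilinear:
  assumes "bounded_bilinear h"
  shows "open S \<Longrightarrow> Ck_on k S f \<Longrightarrow> Ck_on k S g \<Longrightarrow> Ck_on k S (\<lambda>x. h (f x) (g x))"
proof (induction k arbitrary: f g)
  case 0
  then show ?case by (simp add: bounded_bilinear.continuous_on[OF assms])
next
  case (Suc k)
  let ?f' = "\<lambda>x. frechet_derivative f (at x)" and ?g' = "\<lambda>x. frechet_derivative g (at x)"
  have "((\<lambda>x. h (f x) (g x)) has_derivative (\<lambda>v. h (f x) (?g' x v) + h (?f' x v) (g x))) (at x)"
    if "x \<in> S" for x
    by (intro bounded_bilinear.FDERIV[OF assms]
        Ck_on_Suc_has_derivative[OF Suc.prems(2) that] Ck_on_Suc_has_derivative[OF Suc.prems(3) that])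
  moreover have "Ck_on k S (\<lambda>x. h (f x) (?g' x v) + h (?f' x v) (g x))" for v
  proof (intro Ck_on_add Suc.IH Suc.prems(1))
    show "Ck_on k S f" "Ck_on k S g"
      using Suc.prems(2,3) by (blast intro: Ck_on_Suc_imp_Ck_on)+
    show "Ck_on k S (\<lambda>x. ?f' x v)" "Ck_on k S (\<lambda>x. ?g' x v)"
      using Suc.prems(2,3) by simp_all
  qed
  ultimately show ?case by (rule Ck_on_SucI[OF Suc.prems(1)])
qed

text \<open>
  The chain rule is expanded in the standard basis, so that the derivative of the composite
  is a finite sum of products of maps that are one degree less smooth; this keeps the
  induction on the order within plain directional derivatives.
\<close>
lemma Ck_on_compose:
  fixes f :: "'a::real_normed_vector \<Rightarrow> 'b::euclidean_space"
  assumes "open S" "open T" "f ` S \<subseteq> T"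
  shows "Ck_on k S f \<Longrightarrow> Ck_on k T g \<Longrightarrow> Ck_on k S (\<lambda>x. g (f x))"
proof (induction k arbitrary: g)
  case 0
  then show ?case using continuous_on_compose2 assms by (metis Ck_on.simps(1))
next
  case (Suc k)
  let ?g' = "\<lambda>y. frechet_derivative g (at y)" and ?f' = "\<lambda>x. frechet_derivative f (at x)"
  have g: "(g has_derivative ?g' (f x)) (at (f x))" if "x \<in> S" for x
    using Ck_on_Suc_has_derivative[OF Suc.prems(2)] that assms(3) by blast
  have "((\<lambda>x. g (f x)) has_derivative (\<lambda>v. \<Sum>i\<in>Basis. (?f' x v \<bullet> i) *\<^sub>R ?g' (f x) i)) (at x)"
    if "x \<in> S" for x
  proof -
    note lin = has_derivative_linear[OF g[OF that]]
    have "?g' (f x) w = (\<Sum>i\<in>Basis. (w \<bullet> i) *\<^sub>R ?g' (f x) i)" for w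
      using linear_sum[OF lin, of "\<lambda>i. (w \<bullet> i) *\<^sub>R i" Basis]
      by (simp add: euclidean_representation linear_scale[OF lin])
    then have "(\<lambda>v. ?g' (f x) (?f' x v)) = (\<lambda>v. \<Sum>i\<in>Basis. (?f' x v \<bullet> i) *\<^sub>R ?g' (f x) i)"
      by (intro ext)
    with has_derivative_compose[OF Ck_on_Suc_has_derivative[OF Suc.prems(1) that] g[OF that]]
    show ?thesis by metis
  qed
  moreover have "Ck_on k S (\<lambda>x. \<Sum>i\<in>Basis. (?f' x v \<bullet> i) *\<^sub>R ?g' (f x) i)" for v
  proof (intro Ck_on_sum Ck_on_bilinear[OF bounded_bilinear_scaleR] assms(1))
    fix i :: 'b
    show "Ck_on k S (\<lambda>x. ?f' x v \<bullet> i)"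
      by (rule Ck_on_bilinear[OF bounded_bilinear_inner assms(1)])
         (use Suc.prems assms Ck_on_const in auto)
    show "Ck_on k S (\<lambda>x. ?g' (f x) i)"
      by (rule Suc.IH) (use Suc.prems Ck_on_Suc_imp_Ck_on in auto)
  qed
  ultimately show ?case by (rule Ck_on_SucI[OF assms(1)])
qed

lemma smooth_on_compose:
  fixes f :: "'a::real_normed_vector \<Rightarrow> 'b::euclidean_space"
  assumes "open S" "open T" "f ` S \<subseteq> T" "smooth_on S f" "smooth_on T g"
  shows "smooth_on S (\<lambda>x. g (f x))"
  using assms Ck_on_compose unfolding smooth_on_def by blast

lemma smooth_on_line: "open S \<Longrightarrow> smooth_on S (\<lambda>t. y + t *\<^sub>R u)"
  unfolding smooth_on_def
  by (intro allI Ck_on_add Ck_on_const Ck_on_bounded_linear bounded_linear_scaleR_left)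

lemma smooth_on_imp_has_derivative:
  assumes "smooth_on S f" "x \<in> S"
  shows "(f has_derivative frechet_derivative f (at x)) (at x)"
  using assms Ck_on_Suc_has_derivative unfolding smooth_on_def by blast

lemma smooth_on_frechet_derivative:
  "smooth_on S f \<Longrightarrow> smooth_on S (\<lambda>x. frechet_derivative f (at x) v)"
  unfolding smooth_on_def using Ck_on.simps(2) by blast

lemma smooth_on_imp_continuous_on: "smooth_on S f \<Longrightarrow> continuous_on S f"
  unfolding smooth_on_def using Ck_on.simps(1) by blast

section \<open>Curves and slice charts\<close>

text \<open>
  The outer normal without its orientation: the local computations are insensitive to the sign
  of the normal.
\<close>
definition unit_normal :: "'a::euclidean_space set \<Rightarrow> 'a \<Rightarrow> 'a \<Rightarrow> bool"
where
  "unit_normal M p \<nu> \<longleftrightarrow> norm \<nu> = 1 \<and> (\<forall>v\<in>tangent_space M p. \<nu> \<bullet> v = 0)"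

lemma has_vector_derivative_along_line:
  assumes "(f has_derivative f') (at (y + t *\<^sub>R u))"
  shows "((\<lambda>s. f (y + s *\<^sub>R u)) has_vector_derivative f' u) (at t)"
proof -
  have "((\<lambda>s. y + s *\<^sub>R u) has_derivative (\<lambda>s. s *\<^sub>R u)) (at t)"
    by (auto intro!: derivative_eq_intros)
  from has_derivative_compose[OF this assms] show ?thesis
    unfolding has_vector_derivative_def
    by (simp add: linear_scale[OF has_derivative_linear[OF assms]])
qed

lemma line_in_open:
  fixes V :: "'a::real_normed_vector set"
  assumes "open V" "y \<in> V"
  obtains \<epsilon> where "\<epsilon> > 0" "\<And>t::real. \<bar>t\<bar> < \<epsilon> \<Longrightarrow> y + t *\<^sub>R u \<in> V"
proof -
  have "open ((\<lambda>t::real. y + t *\<^sub>R u) -` V)"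
    by (intro open_vimage assms(1) continuous_intros)
  moreover have "0 \<in> (\<lambda>t::real. y + t *\<^sub>R u) -` V" using assms(2) by simp
  ultimately obtain \<epsilon> where \<epsilon>: "\<epsilon> > 0" "ball 0 \<epsilon> \<subseteq> (\<lambda>t::real. y + t *\<^sub>R u) -` V"
    using openE by blast
  show thesis
  proof (rule that[OF \<epsilon>(1)])
    show "y + t *\<^sub>R u \<in> V" if "\<bar>t\<bar> < \<epsilon>" for t :: real
      using subsetD[OF \<epsilon>(2), of t] that by simp
  qed
qed

lemma has_vector_derivative_tendsto_quotient:
  assumes "(f has_vector_derivative D) (at 0)" "f 0 = 0"
  shows "((\<lambda>t. (1 / t) *\<^sub>R f t) \<longlongrightarrow> D) (at 0)"
proof -
  have "((\<lambda>t. norm (f t - t *\<^sub>R D) / norm t) \<longlongrightarrow> 0) (at 0)"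
    using assms unfolding has_vector_derivative_def has_derivative_at by simp
  then have "((\<lambda>t. norm ((1 / t) *\<^sub>R f t - D)) \<longlongrightarrow> 0) (at 0)"
  proof (rule Lim_transform_eventually)
    have "norm (f t - t *\<^sub>R D) / norm t = norm ((1 / t) *\<^sub>R f t - D)" if "t \<noteq> 0" for t
    proof -
      have "(1 / t) *\<^sub>R f t - D = (1 / t) *\<^sub>R (f t - t *\<^sub>R D)"
        using that by (simp add: scaleR_diff_right)
      then show ?thesis by simp
    qed
    then show "\<forall>\<^sub>F t in at 0. norm (f t - t *\<^sub>R D) / norm t = norm ((1 / t) *\<^sub>R f t - D)"
      by (simp add: eventually_at_filter)
  qed
  then show ?thesis by (simp add: tendsto_norm_zero_iff LIM_zero_iff)
qed

lemma second_derivative_test_max: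
  fixes f g :: "real \<Rightarrow> real"
  assumes "d > 0" and max: "\<And>t. \<bar>t\<bar> < d \<Longrightarrow> f t \<le> f 0"
    and f: "\<And>t. \<bar>t\<bar> < d \<Longrightarrow> (f has_real_derivative g t) (at t)"
    and g: "(g has_real_derivative c) (at 0)"
  shows "g 0 = 0" "c \<le> 0"
proof -
  show g0: "g 0 = 0"
    using DERIV_local_max[OF f[of 0] assms(1)] assms(1) max by simp
  show "c \<le> 0"
  proof (rule ccontr)
    assume "\<not> c \<le> 0"
    then obtain e where e: "e > 0" "\<And>h. 0 < h \<Longrightarrow> h < e \<Longrightarrow> 0 < g h"
      using DERIV_pos_inc_right[OF g] g0 by auto
    define h where "h = min d e / 2"
    have h: "0 < h" "h < d" "h < e" using \<open>d > 0\<close> e(1) by (auto simp: h_def min_def)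
    have "f 0 < f h"
    proof (rule DERIV_pos_imp_increasing_open[OF h(1)])
      show "\<exists>y. (f has_real_derivative y) (at x) \<and> 0 < y" if "0 < x" "x < h" for x
        using f[of x] e(2)[of x] that h by auto
      show "continuous_on {0..h} f"
        using DERIV_isCont[OF f] h by (intro continuous_at_imp_continuous_on) auto
    qed
    with max[of h] h show False by simp
  qed
qed

text \<open>
  One of the flattening diffeomorphisms in the definition of an embedded hypersurface. Straight
  lines in the hyperplane orthogonal to \<open>b\<close> are mapped by \<open>\<psi>\<close> to curves in \<open>M\<close>, which serve as test
  curves throughout.
\<close>
locale slice_chart =
  fixes M U V :: "'a::euclidean_space set" and \<phi> \<psi> :: "'a \<Rightarrow> 'a" and b :: 'a
  assumes b: "b \<in> Basis" and openU: "open U" and openV: "open V"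
    and homeo: "homeomorphism U V \<phi> \<psi>"
    and smooth_\<phi>: "smooth_on U \<phi>" and smooth_\<psi>: "smooth_on V \<psi>"
    and slice: "\<phi> ` (M \<inter> U) = V \<inter> {y. y \<bullet> b = 0}"
begin

abbreviation "d\<phi> q \<equiv> frechet_derivative \<phi> (at q)"
abbreviation "d\<psi> y \<equiv> frechet_derivative \<psi> (at y)"

text \<open>
  The acceleration at \<open>\<psi> y\<close> of the curve \<open>t \<mapsto> \<psi> (y + t u)\<close>.
\<close>
definition dd\<psi> :: "'a \<Rightarrow> 'a \<Rightarrow> 'a" where
  "dd\<psi> y u = frechet_derivative (\<lambda>z. d\<psi> z u) (at y) u"

lemma \<phi>_in: "q \<in> U \<Longrightarrow> \<phi> q \<in> V" and \<psi>_in: "y \<in> V \<Longrightarrow> \<psi> y \<in> U"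
  and \<psi>_\<phi>: "q \<in> U \<Longrightarrow> \<psi> (\<phi> q) = q" and \<phi>_\<psi>: "y \<in> V \<Longrightarrow> \<phi> (\<psi> y) = y"
  using homeo unfolding homeomorphism_def by auto

lemma slice_\<phi>: "q \<in> M \<Longrightarrow> q \<in> U \<Longrightarrow> \<phi> q \<bullet> b = 0"
  using slice by blast

lemma slice_\<psi>:
  assumes "y \<in> V" "y \<bullet> b = 0" shows "\<psi> y \<in> M"
proof -
  obtain q where "q \<in> M \<inter> U" "y = \<phi> q" using slice assms by blast
  then show ?thesis using \<psi>_\<phi> by auto
qed

lemma \<phi>_deriv: "q \<in> U \<Longrightarrow> (\<phi> has_derivative d\<phi> q) (at q)"
  and \<psi>_deriv: "y \<in> V \<Longrightarrow> (\<psi> has_derivative d\<psi> y) (at y)"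
  using smooth_on_imp_has_derivative smooth_\<phi> smooth_\<psi> by blast+

lemmas linear_d\<phi> = \<phi>_deriv[THEN has_derivative_linear]
lemmas linear_d\<psi> = \<psi>_deriv[THEN has_derivative_linear]

lemma d\<psi>_d\<phi>: "q \<in> U \<Longrightarrow> d\<psi> (\<phi> q) (d\<phi> q v) = v"
proof -
  assume q: "q \<in> U"
  have "((\<lambda>x. \<psi> (\<phi> x)) has_derivative (\<lambda>v. d\<psi> (\<phi> q) (d\<phi> q v))) (at q)"
    using has_derivative_compose[OF \<phi>_deriv \<psi>_deriv] q \<phi>_in by blast
  moreover have "((\<lambda>x. \<psi> (\<phi> x)) has_derivative (\<lambda>v. v)) (at q)"
    by (rule has_derivative_transform_within_open[OF has_derivative_ident openU q]) (simp add: \<psi>_\<phi>)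
  ultimately show ?thesis using has_derivative_unique by metis
qed

lemma d\<phi>_d\<psi>: "y \<in> V \<Longrightarrow> d\<phi> (\<psi> y) (d\<psi> y u) = u"
proof -
  assume y: "y \<in> V"
  have "((\<lambda>x. \<phi> (\<psi> x)) has_derivative (\<lambda>v. d\<phi> (\<psi> y) (d\<psi> y v))) (at y)"
    using has_derivative_compose[OF \<psi>_deriv \<phi>_deriv] y \<psi>_in by blast
  moreover have "((\<lambda>x. \<phi> (\<psi> x)) has_derivative (\<lambda>v. v)) (at y)"
    by (rule has_derivative_transform_within_open[OF has_derivative_ident openV y]) (simp add: \<phi>_\<psi>)
  ultimately show ?thesis using has_derivative_unique by metis
qed

lemma slice_line_velocity:
  "y + t *\<^sub>R u \<in> V \<Longrightarrow>
    ((\<lambda>s. \<psi> (y + s *\<^sub>R u)) has_vector_derivative d\<psi> (y + t *\<^sub>R u) u) (at t)"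
  by (intro has_vector_derivative_along_line \<psi>_deriv)

lemma slice_line_acceleration:
  "y + t *\<^sub>R u \<in> V \<Longrightarrow>
    ((\<lambda>s. d\<psi> (y + s *\<^sub>R u) u) has_vector_derivative dd\<psi> (y + t *\<^sub>R u) u) (at t)"
  unfolding dd\<psi>_def
  by (rule has_vector_derivative_along_line[where f = "\<lambda>z. d\<psi> z u"
        and f' = "frechet_derivative (\<lambda>z. d\<psi> z u) (at (y + t *\<^sub>R u))"])
     (rule smooth_on_imp_has_derivative[OF smooth_on_frechet_derivative[OF smooth_\<psi>]])

lemma dd\<psi>_scaleR:
  assumes y: "y \<in> V" shows "dd\<psi> y (k *\<^sub>R u) = k\<^sup>2 *\<^sub>R dd\<psi> y u"
proof -
  let ?D = "frechet_derivative (\<lambda>z. d\<psi> z u) (at y)"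
  have D: "((\<lambda>z. d\<psi> z u) has_derivative ?D) (at y)"
    by (intro smooth_on_imp_has_derivative[OF _ y] smooth_on_frechet_derivative smooth_\<psi>)
  have "((\<lambda>z. d\<psi> z (k *\<^sub>R u)) has_derivative (\<lambda>v. k *\<^sub>R ?D v)) (at y)"
    by (rule has_derivative_transform_within_open[OF has_derivative_scaleR_right[OF D] openV y])
       (simp add: linear_scale[OF linear_d\<psi>])
  from frechet_derivative_at[OF this, symmetric] show ?thesis
    by (simp add: dd\<psi>_def linear_scale[OF has_derivative_linear[OF D]] power2_eq_square)
qed

lemma d\<psi>_in_tangent_space:
  assumes y: "y \<in> V" "y \<bullet> b = 0" and u: "u \<bullet> b = 0"
  shows "d\<psi> y u \<in> tangent_space M (\<psi> y)"
proof -
  obtain \<epsilon> where \<epsilon>: "\<epsilon> > 0" "\<And>t. \<bar>t\<bar> < \<epsilon> \<Longrightarrow> y + t *\<^sub>R u \<in> V"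
    using line_in_open[OF openV y(1)] by blast
  let ?\<gamma> = "\<lambda>t. \<psi> (y + t *\<^sub>R u)"
  have "smooth_on {-\<epsilon><..<\<epsilon>} ?\<gamma>"
    by (rule smooth_on_compose[OF _ openV _ smooth_on_line smooth_\<psi>]) (use \<epsilon> in auto)
  moreover have "?\<gamma> ` {-\<epsilon><..<\<epsilon>} \<subseteq> M"
    using \<epsilon> y u by (auto intro!: slice_\<psi> simp: inner_add_left)
  moreover have "(?\<gamma> has_vector_derivative d\<psi> y u) (at 0)"
    using slice_line_velocity[of y 0 u] y by simp
  ultimately show ?thesis unfolding tangent_space_def using \<epsilon>(1)
    by (auto intro!: exI[of _ ?\<gamma>] exI[of _ \<epsilon>])
qed

lemma tangent_space_eq:
  assumes q: "q \<in> M" "q \<in> U"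
  shows "tangent_space M q = {v. d\<phi> q v \<bullet> b = 0}"
proof (intro equalityI subsetI)
  fix v assume "v \<in> tangent_space M q"
  then obtain \<gamma> \<epsilon> where \<epsilon>: "\<epsilon> > 0" and \<gamma>: "\<gamma> ` {-\<epsilon><..<\<epsilon>} \<subseteq> M" "\<gamma> 0 = q"
    "(\<gamma> has_vector_derivative v) (at (0::real))"
    unfolding tangent_space_def mem_Collect_eq by (elim exE conjE)
  have "((\<lambda>t. \<phi> (\<gamma> t) \<bullet> b) has_derivative (\<lambda>t. d\<phi> q (t *\<^sub>R v) \<bullet> b)) (at 0)"
    using has_derivative_compose[OF \<gamma>(3)[unfolded has_vector_derivative_def]] \<phi>_deriv[OF q(2)] \<gamma>(2)
    by (intro has_derivative_inner_left) simp
  then have 1: "((\<lambda>t. \<phi> (\<gamma> t) \<bullet> b) has_derivative (\<lambda>t. t * (d\<phi> q v \<bullet> b))) (at 0)"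
    by (simp add: linear_scale[OF linear_d\<phi>[OF q(2)]])
  obtain S where S: "open S" "0 \<in> S" "\<And>t. t \<in> S \<Longrightarrow> \<gamma> t \<in> U"
    using has_vector_derivative_continuous[OF \<gamma>(3)] \<gamma>(2) q openU by (metis continuous_at_open)
  have 2: "((\<lambda>t. \<phi> (\<gamma> t) \<bullet> b) has_derivative (\<lambda>t. 0)) (at 0)"
  proof (rule has_derivative_transform_within_open[OF has_derivative_const])
    show "open (S \<inter> {-\<epsilon><..<\<epsilon>})" "0 \<in> S \<inter> {-\<epsilon><..<\<epsilon>}"
      using S \<epsilon> by auto
    show "0 = \<phi> (\<gamma> t) \<bullet> b" if "t \<in> S \<inter> {-\<epsilon><..<\<epsilon>}" for t
      using that \<gamma>(1) S(3) slice_\<phi>[of "\<gamma> t"] by (auto simp: image_subset_iff)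
  qed
  from fun_cong[OF has_derivative_unique[OF 1 2], of 1] show "v \<in> {v. d\<phi> q v \<bullet> b = 0}"
    by simp
next
  fix v assume "v \<in> {v. d\<phi> q v \<bullet> b = 0}"
  then show "v \<in> tangent_space M q"
    using d\<psi>_in_tangent_space[of "\<phi> q" "d\<phi> q v"] q by (simp add: \<phi>_in slice_\<phi> d\<psi>_d\<phi> \<psi>_\<phi>)
qed

lemma tangent_extension_exists:
  assumes q: "q \<in> M" "q \<in> U" and w: "w \<in> tangent_space M q"
  shows "\<exists>W. tangent_extension M q w W"
proof -
  let ?W = "\<lambda>x. d\<psi> (\<phi> x) (d\<phi> q w)"
  have "smooth_on U ?W"
    by (rule smooth_on_compose[OF openU openV _ smooth_\<phi> smooth_on_frechet_derivative[OF smooth_\<psi>]])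
       (use \<phi>_in in blast)
  moreover have "?W x \<in> tangent_space M x" if "x \<in> M \<inter> U" for x
    using d\<psi>_in_tangent_space[of "\<phi> x" "d\<phi> q w"] that w tangent_space_eq[OF q]
    by (auto simp: \<phi>_in slice_\<phi> \<psi>_\<phi>)
  moreover have "?W q = w" using d\<psi>_d\<phi> q by simp
  ultimately show ?thesis unfolding tangent_extension_def using openU q by blast
qed

text \<open>
  The tangent space is the kernel of the linear functional \<open>L v = d\<phi> q v \<bullet> b\<close>. For every \<open>v\<close> the
  vector \<open>L v \<nu> - L \<nu> v\<close> lies in this kernel, so it is orthogonal to \<open>\<nu>\<close>; if \<open>v\<close> is orthogonal to
  \<open>\<nu>\<close> this leaves \<open>L v = 0\<close>.
\<close>
lemma tangent_space_hyperplane: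
  assumes q: "q \<in> M" "q \<in> U" and \<nu>: "unit_normal M q \<nu>"
  shows "tangent_space M q = {v. \<nu> \<bullet> v = 0}"
proof (intro equalityI subsetI)
  fix v assume v: "v \<in> {v. \<nu> \<bullet> v = 0}"
  let ?L = "\<lambda>x. d\<phi> q x \<bullet> b"
  let ?z = "?L v *\<^sub>R \<nu> - ?L \<nu> *\<^sub>R v"
  have "?z \<in> tangent_space M q"
    by (simp add: tangent_space_eq[OF q] linear_diff[OF linear_d\<phi>[OF q(2)]]
        linear_scale[OF linear_d\<phi>[OF q(2)]] inner_diff_left)
  then have "\<nu> \<bullet> ?z = 0" and "\<nu> \<bullet> \<nu> = 1"
    using \<nu> by (auto simp: unit_normal_def norm_eq_1)
  then have "?L v = 0" using v by (simp add: inner_diff_right)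
  then show "v \<in> tangent_space M q" by (simp add: tangent_space_eq[OF q])
qed (use \<nu> in \<open>auto simp: unit_normal_def\<close>)

text \<open>
  Let \<open>W\<close> be the chosen tangent extension and \<open>\<gamma> t = \<psi> (y + t u)\<close> the test curve with velocity \<open>w\<close>.
  Both \<open>W (\<gamma> t)\<close> and \<open>\<gamma>' t\<close> are tangent at \<open>\<gamma> t\<close>, and they agree at \<open>t = 0\<close>. So their difference \<open>X\<close>
  vanishes at 0, the quotients \<open>X t / t\<close> are tangent at \<open>\<gamma> t\<close>, and by continuity of \<open>d\<phi>\<close> their limit
  \<open>D = dW w - \<gamma>'' 0\<close> is tangent at \<open>q\<close>. Its normal component is zero, whatever \<open>W\<close> was.
\<close>
lemma second_fundamental_form_eq:
  assumes q: "q \<in> M" "q \<in> U" and \<nu>: "unit_normal M q \<nu>" and w: "w \<in> tangent_space M q"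
  shows "second_fundamental_form M q \<nu> w w = dd\<psi> (\<phi> q) (d\<phi> q w) \<bullet> \<nu>"
proof -
  define W where "W = (SOME W. tangent_extension M q w W)"
  have "tangent_extension M q w W"
    unfolding W_def using tangent_extension_exists[OF q w] by (rule someI_ex)
  then obtain N where N: "open N" "q \<in> N" and W: "smooth_on N W"
    "\<And>x. x \<in> M \<Longrightarrow> x \<in> N \<Longrightarrow> W x \<in> tangent_space M x" "W q = w"
    unfolding tangent_extension_def by auto
  define y u where "y = \<phi> q" and "u = d\<phi> q w"
  have y: "y \<in> V" "y \<bullet> b = 0" "\<psi> y = q" and u: "u \<bullet> b = 0"
    using q w tangent_space_eq[OF q] by (auto simp: y_def u_def \<phi>_in slice_\<phi> \<psi>_\<phi>)
  define \<gamma> where "\<gamma> = (\<lambda>t. \<psi> (y + t *\<^sub>R u))"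
  define X where "X = (\<lambda>t. W (\<gamma> t) - d\<psi> (y + t *\<^sub>R u) u)"
  define D where "D = frechet_derivative W (at q) w - dd\<psi> y u"
  have \<gamma>0: "\<gamma> 0 = q" using y by (simp add: \<gamma>_def)
  have \<gamma>': "(\<gamma> has_vector_derivative w) (at 0)"
    using slice_line_velocity[of y 0 u] y d\<psi>_d\<phi>[OF q(2), of w] by (simp add: \<gamma>_def y_def u_def)
  have X0: "X 0 = 0"
    using \<gamma>0 W(3) d\<psi>_d\<phi>[OF q(2), of w] by (simp add: X_def y_def u_def)
  have dW: "(W has_derivative frechet_derivative W (at q)) (at (\<gamma> 0))"
    unfolding \<gamma>0 by (rule smooth_on_imp_has_derivative[OF W(1) N(2)])
  have "((\<lambda>t. W (\<gamma> t)) has_vector_derivative frechet_derivative W (at q) w) (at 0)"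
    using has_derivative_compose[OF \<gamma>'[unfolded has_vector_derivative_def] dW]
    unfolding has_vector_derivative_def by (simp add: linear_scale[OF has_derivative_linear[OF dW]])
  then have X': "(X has_vector_derivative D) (at 0)"
    unfolding X_def D_def using slice_line_acceleration[of y 0 u] y
    by (auto intro!: has_vector_derivative_diff)
  have X_lim: "((\<lambda>t. (1 / t) *\<^sub>R X t) \<longlongrightarrow> D) (at 0)"
    by (rule has_vector_derivative_tendsto_quotient[OF X' X0])
  have \<gamma>_lim: "\<gamma> \<midarrow>0\<rightarrow> q"
    using has_vector_derivative_continuous[OF \<gamma>'] \<gamma>0 by (simp add: continuous_at)
  obtain \<epsilon> where \<epsilon>: "\<epsilon> > 0" "\<And>t. \<bar>t\<bar> < \<epsilon> \<Longrightarrow> y + t *\<^sub>R u \<in> V"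
    using line_in_open[OF openV y(1)] by blast
  have "\<forall>\<^sub>F t in at 0. \<bar>t\<bar> < \<epsilon>"
    using \<epsilon>(1) by (auto simp: eventually_at dist_real_def)
  moreover have "\<forall>\<^sub>F t in at 0. \<gamma> t \<in> N"
    using topological_tendstoD[OF \<gamma>_lim N] .
  ultimately have "\<forall>\<^sub>F t in at 0. d\<phi> (\<gamma> t) ((1 / t) *\<^sub>R X t) \<bullet> b = 0"
  proof eventually_elim
    case (elim t)
    have t: "y + t *\<^sub>R u \<in> V" "(y + t *\<^sub>R u) \<bullet> b = 0"
      using \<epsilon>(2) elim y u by (auto simp: inner_add_left)
    then have \<gamma>t: "\<gamma> t \<in> M" "\<gamma> t \<in> U"
      by (auto simp: \<gamma>_def slice_\<psi> \<psi>_in)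
    have "W (\<gamma> t) \<in> tangent_space M (\<gamma> t)" "d\<psi> (y + t *\<^sub>R u) u \<in> tangent_space M (\<gamma> t)"
      using W(2) \<gamma>t elim d\<psi>_in_tangent_space[OF t u] by (auto simp: \<gamma>_def)
    then show ?case
      by (simp add: X_def tangent_space_eq[OF \<gamma>t] linear_diff[OF linear_d\<phi>[OF \<gamma>t(2)]]
          linear_scale[OF linear_d\<phi>[OF \<gamma>t(2)]] inner_diff_left)
  qed
  moreover have "((\<lambda>t. d\<phi> (\<gamma> t) ((1 / t) *\<^sub>R X t)) \<longlongrightarrow> d\<phi> q D) (at 0)"
  proof -
    have exp: "d\<phi> x v = (\<Sum>i\<in>Basis. (v \<bullet> i) *\<^sub>R d\<phi> x i)" if "x \<in> U" for x v
      using linear_sum[OF linear_d\<phi>[OF that], of "\<lambda>i. (v \<bullet> i) *\<^sub>R i" Basis]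
      by (simp add: euclidean_representation linear_scale[OF linear_d\<phi>[OF that]])
    have cont: "((\<lambda>t. d\<phi> (\<gamma> t) i) \<longlongrightarrow> d\<phi> q i) (at 0)" for i
    proof (rule isCont_tendsto_compose[OF _ \<gamma>_lim])
      show "isCont (\<lambda>x. d\<phi> x i) q"
        using smooth_on_imp_continuous_on[OF smooth_on_frechet_derivative[OF smooth_\<phi>, of i]]
          continuous_on_eq_continuous_at[OF openU] q(2) by blast
    qed
    have "((\<lambda>t. \<Sum>i\<in>Basis. (((1 / t) *\<^sub>R X t) \<bullet> i) *\<^sub>R d\<phi> (\<gamma> t) i)
        \<longlongrightarrow> (\<Sum>i\<in>Basis. (D \<bullet> i) *\<^sub>R d\<phi> q i)) (at 0)"
      by (intro tendsto_sum tendsto_scaleR tendsto_inner tendsto_const X_lim cont)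
    then have "((\<lambda>t. \<Sum>i\<in>Basis. (((1 / t) *\<^sub>R X t) \<bullet> i) *\<^sub>R d\<phi> (\<gamma> t) i) \<longlongrightarrow> d\<phi> q D) (at 0)"
      by (simp only: exp[OF q(2), of D])
    then show ?thesis
    proof (rule Lim_transform_eventually)
      show "\<forall>\<^sub>F t in at 0. (\<Sum>i\<in>Basis. (((1 / t) *\<^sub>R X t) \<bullet> i) *\<^sub>R d\<phi> (\<gamma> t) i)
          = d\<phi> (\<gamma> t) ((1 / t) *\<^sub>R X t)"
        using topological_tendstoD[OF \<gamma>_lim openU q(2)]
        by (rule eventually_mono) (rule exp[symmetric])
    qed
  qed
  from tendsto_inner[OF this tendsto_const]
  have "((\<lambda>t. d\<phi> (\<gamma> t) ((1 / t) *\<^sub>R X t) \<bullet> b) \<longlongrightarrow> d\<phi> q D \<bullet> b) (at 0)" .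
  ultimately have "d\<phi> q D \<bullet> b = 0"
    using tendsto_unique[OF at_neq_bot _ tendsto_eventually] by blast
  then have "\<nu> \<bullet> D = 0" using \<nu> tangent_space_eq[OF q] by (auto simp: unit_normal_def)
  then show ?thesis
    unfolding second_fundamental_form_def W_def[symmetric] D_def y_def u_def
    by (simp add: inner_commute inner_diff_right)
qed

lemma mean_curvature_eq:
  assumes q: "q \<in> M" "q \<in> U" and \<nu>: "unit_normal M q \<nu>"
  obtains B where "card B = DIM('a) - 1" "orthonormal_basis_of (tangent_space M q) B"
    "mean_curvature M q \<nu> = - (\<Sum>w\<in>B. dd\<psi> (\<phi> q) (d\<phi> q w) \<bullet> \<nu>)"
proof -
  let ?T = "tangent_space M q"
  note T = tangent_space_hyperplane[OF q \<nu>]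
  have "subspace ?T" unfolding T by (rule subspace_hyperplane)
  define B where "B = (SOME B. orthonormal_basis_of ?T B)"
  have B: "orthonormal_basis_of ?T B"
    unfolding B_def
  proof (rule someI_ex)
    obtain B where "B \<subseteq> ?T" "pairwise orthogonal B" "\<And>x. x \<in> B \<Longrightarrow> norm x = 1" "span B = ?T"
      using orthonormal_basis_subspace[OF \<open>subspace ?T\<close>] by metis
    then show "\<exists>B. orthonormal_basis_of ?T B" unfolding orthonormal_basis_of_def by blast
  qed
  have ind: "independent B"
    using B by (intro pairwise_orthogonal_independent) (auto simp: orthonormal_basis_of_def)
  have card: "card B = DIM('a) - 1"
  proof -
    have "\<nu> \<noteq> 0" using \<nu> by (auto simp: unit_normal_def)
    have "card B = dim (span B)"
      using indep_card_eq_dim_span[OF ind] by simp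
    also have "span B = {v. \<nu> \<bullet> v = 0}" using B by (simp add: orthonormal_basis_of_def T)
    finally show ?thesis using dim_hyperplane[OF \<open>\<nu> \<noteq> 0\<close>] by simp
  qed
  have "mean_curvature M q \<nu> = - (\<Sum>w\<in>B. dd\<psi> (\<phi> q) (d\<phi> q w) \<bullet> \<nu>)"
    unfolding mean_curvature_def trace_on_def B_def[symmetric]
  proof (intro arg_cong[where f = uminus] sum.cong refl)
    fix w assume "w \<in> B"
    with B have "w \<in> ?T" unfolding orthonormal_basis_of_def by blast
    then show "second_fundamental_form M q \<nu> w w = dd\<psi> (\<phi> q) (d\<phi> q w) \<bullet> \<nu>"
      by (rule second_fundamental_form_eq[OF q \<nu>])
  qed
  then show thesis by (rule that[OF card B])
qed

end

lemma has_real_derivative_inner: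
  assumes "(f has_vector_derivative f') (at t)" "(g has_vector_derivative g') (at t)"
  shows "((\<lambda>t. f t \<bullet> g t) has_real_derivative f t \<bullet> g' + f' \<bullet> g t) (at t)"
  unfolding has_real_derivative_iff_has_vector_derivative
  by (rule bounded_bilinear.has_vector_derivative[OF bounded_bilinear_inner assms])

section \<open>Farthest points and the maximum principle for curves\<close>

text \<open>
  Parseval's identity for the orthogonal basis \<open>g, \<nu>\<close> of the plane, multiplied by \<open>g \<bullet> g\<close> so that
  \<open>g\<close> need not be normalized.
\<close>
lemma orthogonal_frame_inner_plane:
  fixes g \<nu> x z :: "'a::euclidean_space"
  assumes dim: "DIM('a) = 2" and \<nu>: "norm \<nu> = 1" and g: "g \<bullet> \<nu> = 0"
  shows "(x \<bullet> z) * (g \<bullet> g) = (x \<bullet> g) * (z \<bullet> g) + (x \<bullet> \<nu>) * (z \<bullet> \<nu>) * (g \<bullet> g)"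
proof (cases "g = 0")
  case False
  define v where "v = (g \<bullet> g) *\<^sub>R x - (x \<bullet> g) *\<^sub>R g - ((x \<bullet> \<nu>) * (g \<bullet> g)) *\<^sub>R \<nu>"
  have \<nu>\<nu>: "\<nu> \<bullet> \<nu> = 1" using \<nu> by (simp add: norm_eq_1)
  have vg: "v \<bullet> g = 0"
    using g by (simp add: v_def inner_diff_left inner_commute[of \<nu> g])
  have v\<nu>: "v \<bullet> \<nu> = 0"
    using g \<nu>\<nu> by (simp add: v_def inner_diff_left)
  have "v = 0"
  proof (rule ccontr)
    assume "v \<noteq> 0"
    have ne: "v \<noteq> g" "v \<noteq> \<nu>" "g \<noteq> \<nu>"
      using vg v\<nu> g \<open>v \<noteq> 0\<close> False by auto
    have "pairwise orthogonal {v, g, \<nu>}"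
      using vg v\<nu> g by (auto simp: pairwise_def orthogonal_def inner_commute)
    then have "independent {v, g, \<nu>}"
      using \<open>v \<noteq> 0\<close> False \<nu> by (intro pairwise_orthogonal_independent) auto
    from independent_bound[OF this] show False using ne dim by simp
  qed
  then have "v \<bullet> z = 0" by simp
  then show ?thesis
    by (simp add: v_def inner_diff_left inner_commute[of _ z] algebra_simps)
qed simp

context slice_chart
begin

lemma slice_neighbourhood:
  assumes q: "q \<in> M" "q \<in> U" and N: "open N" "q \<in> N"
  obtains N' r where "open N'" "q \<in> N'" "N' \<subseteq> U \<inter> N" "r > 0" "ball (\<phi> q) r \<subseteq> V"
    "M \<inter> N' = \<psi> ` (ball (\<phi> q) r \<inter> {y. y \<bullet> b = 0})"
proof -
  have "open (V \<inter> \<psi> -` N)"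
    by (intro continuous_open_preimage smooth_on_imp_continuous_on smooth_\<psi> openV N)
  moreover have "\<phi> q \<in> V \<inter> \<psi> -` N" using q N by (simp add: \<phi>_in \<psi>_\<phi>)
  ultimately obtain r where r: "r > 0" "ball (\<phi> q) r \<subseteq> V \<inter> \<psi> -` N" using openE by blast
  define N' where "N' = U \<inter> \<phi> -` ball (\<phi> q) r"
  have "open N'"
    unfolding N'_def
    by (intro continuous_open_preimage smooth_on_imp_continuous_on smooth_\<phi> openU open_ball)
  moreover have "q \<in> N'" using q r by (simp add: N'_def)
  moreover have "N' \<subseteq> U \<inter> N"
  proof
    fix x assume x: "x \<in> N'"
    then have "x \<in> U" "\<phi> x \<in> V \<inter> \<psi> -` N" using r by (auto simp: N'_def)
    then show "x \<in> U \<inter> N" by (simp add: \<psi>_\<phi>)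
  qed
  moreover have "ball (\<phi> q) r \<subseteq> V" using r by blast
  moreover have "M \<inter> N' = \<psi> ` (ball (\<phi> q) r \<inter> {y. y \<bullet> b = 0})"
  proof (intro equalityI subsetI)
    fix x assume x: "x \<in> M \<inter> N'"
    then have "\<phi> x \<in> ball (\<phi> q) r \<inter> {y. y \<bullet> b = 0}" "x = \<psi> (\<phi> x)"
      by (simp_all add: N'_def slice_\<phi> \<psi>_\<phi>)
    then show "x \<in> \<psi> ` (ball (\<phi> q) r \<inter> {y. y \<bullet> b = 0})" by (rule rev_image_eqI)
  next
    fix x assume "x \<in> \<psi> ` (ball (\<phi> q) r \<inter> {y. y \<bullet> b = 0})"
    then obtain y where y: "y \<in> ball (\<phi> q) r" "y \<bullet> b = 0" "x = \<psi> y" by blast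
    then have "y \<in> V" using r by blast
    with y show "x \<in> M \<inter> N'" by (simp add: N'_def slice_\<psi> \<psi>_in \<phi>_\<psi>)
  qed
  ultimately show thesis using that r(1) by blast
qed

text \<open>
  Near \<open>q\<close> the hypersurface is the image of a convex piece of a hyperplane, hence connected.
\<close>
lemma component_neighbourhood:
  assumes q: "q \<in> M" "q \<in> U" and x: "q \<in> connected_component_set M x"
  shows "\<exists>N. open N \<and> q \<in> N \<and> M \<inter> N \<subseteq> connected_component_set M x"
proof -
  obtain N r where N: "open N" "q \<in> N" "ball (\<phi> q) r \<subseteq> V"
    "M \<inter> N = \<psi> ` (ball (\<phi> q) r \<inter> {y. y \<bullet> b = 0})"
    using slice_neighbourhood[OF q open_UNIV UNIV_I] by metis
  have "{y. y \<bullet> b = 0} = {y. b \<bullet> y = 0}" by (simp add: inner_commute)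
  then have "connected (ball (\<phi> q) r \<inter> {y. y \<bullet> b = 0})"
    by (simp add: convex_connected convex_Int convex_hyperplane)
  moreover have "continuous_on (ball (\<phi> q) r \<inter> {y. y \<bullet> b = 0}) \<psi>"
    using continuous_on_subset[OF smooth_on_imp_continuous_on[OF smooth_\<psi>]] N(3) by blast
  ultimately have "connected (M \<inter> N)"
    unfolding N(4) by (rule connected_continuous_image[rotated])
  then have "M \<inter> N \<subseteq> connected_component_set M q"
    using q(1) N(2) by (intro connected_component_maximal) auto
  also have "\<dots> = connected_component_set M x"
    using x by (simp add: connected_component_eq)
  finally show ?thesis using N(1,2) by blast
qed

text \<open>
  The second derivative test for \<open>\<bar>\<gamma>\<bar>\<^sup>2 / 2\<close> along test curves \<open>\<gamma>\<close> through the local maximum \<open>q\<close>. The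
  first derivative shows that \<open>q\<close> is orthogonal to the tangent space, i.e. a multiple of \<open>\<nu>\<close>, so the
  second derivative in a unit direction \<open>w\<close> is \<open>1 + A(w, w) (q \<bullet> \<nu>) \<le> 0\<close>. Summing over an
  orthonormal basis yields the trace.
\<close>
lemma farthest_point:
  assumes q: "q \<in> M" "q \<in> U" and \<nu>: "unit_normal M q \<nu>" and N: "open N" "q \<in> N"
    and max: "\<And>x. x \<in> M \<Longrightarrow> x \<in> N \<Longrightarrow> norm x \<le> norm q"
  shows "q = (q \<bullet> \<nu>) *\<^sub>R \<nu>" and "real (DIM('a) - 1) \<le> mean_curvature M q \<nu> * (q \<bullet> \<nu>)"
proof -
  have \<nu>\<nu>: "\<nu> \<bullet> \<nu> = 1" using \<nu> by (simp add: unit_normal_def norm_eq_1)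
  have test: "q \<bullet> w = 0" "w \<bullet> w + q \<bullet> dd\<psi> (\<phi> q) (d\<phi> q w) \<le> 0"
    if w: "w \<in> tangent_space M q" for w
  proof -
    define y u where "y = \<phi> q" and "u = d\<phi> q w"
    have y: "y \<in> V" "y \<bullet> b = 0" "\<psi> y = q" and u: "u \<bullet> b = 0" and w': "d\<psi> y u = w"
      using q w tangent_space_eq[OF q] by (auto simp: y_def u_def \<phi>_in slice_\<phi> \<psi>_\<phi> d\<psi>_d\<phi>)
    have "open (V \<inter> \<psi> -` N)"
      by (intro continuous_open_preimage smooth_on_imp_continuous_on smooth_\<psi> openV N)
    moreover have "y \<in> V \<inter> \<psi> -` N" using y N by simp
    ultimately obtain \<epsilon> where \<epsilon>: "\<epsilon> > 0" "\<And>t. \<bar>t\<bar> < \<epsilon> \<Longrightarrow> y + t *\<^sub>R u \<in> V \<inter> \<psi> -` N"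
      using line_in_open by blast
    let ?\<gamma> = "\<lambda>t. \<psi> (y + t *\<^sub>R u)" and ?\<gamma>' = "\<lambda>t. d\<psi> (y + t *\<^sub>R u) u"
    have \<gamma>: "(?\<gamma> has_vector_derivative ?\<gamma>' t) (at t)"
      and \<gamma>': "(?\<gamma>' has_vector_derivative dd\<psi> (y + t *\<^sub>R u) u) (at t)" if "\<bar>t\<bar> < \<epsilon>" for t
      using slice_line_velocity[of y t u] slice_line_acceleration[of y t u] \<epsilon>(2)[OF that] by blast+
    have f: "((\<lambda>t. (?\<gamma> t \<bullet> ?\<gamma> t) / 2) has_real_derivative ?\<gamma> t \<bullet> ?\<gamma>' t) (at t)" if "\<bar>t\<bar> < \<epsilon>" for t
      using DERIV_cdivide[OF has_real_derivative_inner[OF \<gamma>[OF that] \<gamma>[OF that]], of 2]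
      by (simp add: inner_commute)
    have f': "((\<lambda>t. ?\<gamma> t \<bullet> ?\<gamma>' t) has_real_derivative q \<bullet> dd\<psi> y u + w \<bullet> w) (at 0)"
      using has_real_derivative_inner[OF \<gamma>[of 0] \<gamma>'[of 0]] \<epsilon>(1) y(3) w' by simp
    have le: "(?\<gamma> t \<bullet> ?\<gamma> t) / 2 \<le> (?\<gamma> 0 \<bullet> ?\<gamma> 0) / 2" if "\<bar>t\<bar> < \<epsilon>" for t
    proof -
      have "y + t *\<^sub>R u \<in> V" "?\<gamma> t \<in> N" using \<epsilon>(2)[OF that] by auto
      moreover from this have "?\<gamma> t \<in> M" using y u by (intro slice_\<psi>) (auto simp: inner_add_left)
      ultimately have "norm (?\<gamma> t) \<le> norm q" using max by blast
      then show ?thesis using y(3) by (simp add: norm_le)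
    qed
    note second_derivative_test_max[OF \<epsilon>(1) le f f']
    then show "q \<bullet> w = 0" "w \<bullet> w + q \<bullet> dd\<psi> (\<phi> q) (d\<phi> q w) \<le> 0"
      using y(3) w' by (simp_all add: y_def u_def)
  qed
  define w where "w = q - (q \<bullet> \<nu>) *\<^sub>R \<nu>"
  have "\<nu> \<bullet> w = 0" by (simp add: w_def inner_diff_right \<nu>\<nu> inner_commute)
  then have "q \<bullet> w = 0" using test(1) tangent_space_hyperplane[OF q \<nu>] by simp
  moreover have "w \<bullet> w = q \<bullet> w - (q \<bullet> \<nu>) * (\<nu> \<bullet> w)" by (simp add: w_def inner_diff_left)
  ultimately have "w \<bullet> w = 0" using \<open>\<nu> \<bullet> w = 0\<close> by simp
  then show q_eq: "q = (q \<bullet> \<nu>) *\<^sub>R \<nu>" by (simp add: w_def)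
  obtain B where B: "card B = DIM('a) - 1" "orthonormal_basis_of (tangent_space M q) B"
    "mean_curvature M q \<nu> = - (\<Sum>w\<in>B. dd\<psi> (\<phi> q) (d\<phi> q w) \<bullet> \<nu>)"
    using mean_curvature_eq[OF q \<nu>] by blast
  have "1 \<le> - (dd\<psi> (\<phi> q) (d\<phi> q w) \<bullet> \<nu>) * (q \<bullet> \<nu>)" if "w \<in> B" for w
  proof -
    let ?a = "dd\<psi> (\<phi> q) (d\<phi> q w)"
    have "w \<in> tangent_space M q" "w \<bullet> w = 1"
      using B(2) that by (auto simp: orthonormal_basis_of_def norm_eq_1)
    moreover have "q \<bullet> ?a = (q \<bullet> \<nu>) * (?a \<bullet> \<nu>)"
      by (subst q_eq) (simp add: inner_commute)
    ultimately show ?thesis using test(2)[of w] by (simp add: mult.commute)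
  qed
  from sum_mono[OF this]
  have "real (card B) \<le> (\<Sum>w\<in>B. - (dd\<psi> (\<phi> q) (d\<phi> q w) \<bullet> \<nu>) * (q \<bullet> \<nu>))" by simp
  then show "real (DIM('a) - 1) \<le> mean_curvature M q \<nu> * (q \<bullet> \<nu>)"
    unfolding B(1,3) by (simp add: sum_distrib_right sum_negf)
qed

text \<open>
  The curvature of a plane curve with respect to an arbitrary regular parametrization: the
  factor is the square of the speed, because the acceleration is quadratic in \<open>u\<close>.
\<close>
lemma planar_mean_curvature:
  assumes dim: "DIM('a) = 2" and y: "y \<in> V" "y \<bullet> b = 0" and u: "u \<bullet> b = 0"
    and \<nu>: "unit_normal M (\<psi> y) \<nu>"
  shows "mean_curvature M (\<psi> y) \<nu> * (d\<psi> y u \<bullet> d\<psi> y u) = - (dd\<psi> y u \<bullet> \<nu>)"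
proof -
  have q: "\<psi> y \<in> M" "\<psi> y \<in> U" using y by (auto simp: slice_\<psi> \<psi>_in)
  obtain B where B: "card B = 1" "orthonormal_basis_of (tangent_space M (\<psi> y)) B"
    "mean_curvature M (\<psi> y) \<nu> = - (\<Sum>w\<in>B. dd\<psi> (\<phi> (\<psi> y)) (d\<phi> (\<psi> y) w) \<bullet> \<nu>)"
    using mean_curvature_eq[OF q \<nu>] dim by auto
  then obtain e where e: "B = {e}" by (auto simp: card_1_singleton_iff)
  have "e \<bullet> e = 1" using B(2) e by (auto simp: orthonormal_basis_of_def norm_eq_1)
  have "d\<psi> y u \<in> span {e}"
    using d\<psi>_in_tangent_space[OF y u] B(2) e by (simp add: orthonormal_basis_of_def)
  then obtain c where c: "d\<psi> y u = c *\<^sub>R e" by (auto simp: span_singleton)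
  have "u = c *\<^sub>R d\<phi> (\<psi> y) e"
    using d\<phi>_d\<psi>[OF y(1), of u] linear_scale[OF linear_d\<phi>[OF q(2)]] c by simp
  then have "dd\<psi> y u = c\<^sup>2 *\<^sub>R dd\<psi> y (d\<phi> (\<psi> y) e)" using dd\<psi>_scaleR[OF y(1)] by simp
  then show ?thesis
    using B(3) e \<phi>_\<psi>[OF y(1)] \<open>e \<bullet> e = 1\<close> by (simp add: c power2_eq_square)
qed

text \<open>
  Every nearby point \<open>x\<close> is reached from \<open>q\<close> by a test curve \<open>\<gamma>\<close> on \<open>[0, 1]\<close>, without
  parametrizing by arc length: \<open>g = (\<gamma> \<bullet> \<gamma>') / \<bar>\<gamma>'\<bar>\<close> already absorbs the change of speed. It is
  nondecreasing and starts at 0, so \<open>\<bar>x\<bar> \<ge> \<bar>q\<bar>\<close>, while \<open>q\<close> was a local maximum.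
\<close>
lemma planar_norm_locally_constant:
  assumes dim: "DIM('a) = 2" and q: "q \<in> M" "q \<in> U"
    and n: "\<And>x. x \<in> M \<Longrightarrow> unit_normal M x (n x)"
    and le: "\<And>x. x \<in> M \<Longrightarrow> mean_curvature M x (n x) * (x \<bullet> n x) \<le> 1"
    and N: "open N" "q \<in> N" and max: "\<And>x. x \<in> M \<Longrightarrow> x \<in> N \<Longrightarrow> norm x \<le> norm q"
  shows "\<exists>N'. open N' \<and> q \<in> N' \<and> (\<forall>x\<in>M \<inter> N'. norm x = norm q)"
proof -
  obtain N' r where N': "open N'" "q \<in> N'" "N' \<subseteq> U \<inter> N" and r: "r > 0" "ball (\<phi> q) r \<subseteq> V"
    and MN': "M \<inter> N' = \<psi> ` (ball (\<phi> q) r \<inter> {y. y \<bullet> b = 0})"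
    by (rule slice_neighbourhood[OF q N])
  have "norm x = norm q" if x: "x \<in> M \<inter> N'" for x
  proof -
    obtain z where z: "z \<in> ball (\<phi> q) r" "z \<bullet> b = 0" "x = \<psi> z" using x MN' by blast
    define u where "u = z - \<phi> q"
    show ?thesis
    proof (cases "u = 0")
      case True
      then show ?thesis using z q by (simp add: u_def \<psi>_\<phi>)
    next
      case False
      let ?y = "\<lambda>t. \<phi> q + t *\<^sub>R u"
      define \<gamma> \<gamma>' \<gamma>'' where "\<gamma> = (\<lambda>t. \<psi> (?y t))" and "\<gamma>' = (\<lambda>t. d\<psi> (?y t) u)"
        and "\<gamma>'' = (\<lambda>t. dd\<psi> (?y t) u)"
      have u: "u \<bullet> b = 0" using z q by (simp add: u_def inner_diff_left slice_\<phi>)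
      have y: "?y t \<in> V" "?y t \<bullet> b = 0" if "0 \<le> t" "t \<le> 1" for t
      proof -
        have "t * norm u \<le> norm u" using that by (simp add: mult_left_le_one_le)
        moreover have "norm u < r" using z by (simp add: u_def dist_norm norm_minus_commute)
        ultimately have "?y t \<in> ball (\<phi> q) r" using that by (simp add: dist_norm)
        then show "?y t \<in> V" using r by blast
        show "?y t \<bullet> b = 0" using q u by (simp add: inner_add_left slice_\<phi>)
      qed
      have D: "(\<gamma> has_vector_derivative \<gamma>' t) (at t)" "(\<gamma>' has_vector_derivative \<gamma>'' t) (at t)"
        if "0 \<le> t" "t \<le> 1" for t
        unfolding \<gamma>_def \<gamma>'_def \<gamma>''_def
        using slice_line_velocity slice_line_acceleration y(1)[OF that] by blast+
      have pos: "\<gamma>' t \<bullet> \<gamma>' t > 0" if "0 \<le> t" "t \<le> 1" for t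
      proof -
        have "d\<phi> (\<psi> (?y t)) (\<gamma>' t) = u" unfolding \<gamma>'_def by (rule d\<phi>_d\<psi>[OF y(1)[OF that]])
        then have "\<gamma>' t \<noteq> 0"
          using False linear_0[OF linear_d\<phi>[OF \<psi>_in[OF y(1)[OF that]]]] by force
        then show ?thesis by simp
      qed
      define g where "g t = (\<gamma> t \<bullet> \<gamma>' t) / sqrt (\<gamma>' t \<bullet> \<gamma>' t)" for t
      have g': "\<exists>c. (g has_real_derivative c) (at t) \<and> c \<ge> 0" if t: "0 \<le> t" "t \<le> 1" for t
      proof -
        define s where "s = \<gamma>' t \<bullet> \<gamma>' t"
        have s: "s > 0" using pos[OF t] by (simp add: s_def)
        let ?\<nu> = "n (\<gamma> t)" let ?H = "mean_curvature M (\<gamma> t) ?\<nu>"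
        have \<gamma>M: "\<gamma> t \<in> M" unfolding \<gamma>_def by (rule slice_\<psi>[OF y[OF t]])
        note \<nu> = n[OF \<gamma>M]
        have "\<gamma>' t \<in> tangent_space M (\<gamma> t)"
          unfolding \<gamma>_def \<gamma>'_def by (rule d\<psi>_in_tangent_space[OF y[OF t] u])
        then have "\<gamma>' t \<bullet> ?\<nu> = 0" and "norm ?\<nu> = 1"
          using \<nu> by (auto simp: unit_normal_def inner_commute)
        from orthogonal_frame_inner_plane[OF dim this(2,1), of "\<gamma> t" "\<gamma>'' t"]
        have frame: "(\<gamma> t \<bullet> \<gamma>'' t) * s = (\<gamma> t \<bullet> \<gamma>' t) * (\<gamma>'' t \<bullet> \<gamma>' t) + (\<gamma> t \<bullet> ?\<nu>) * (\<gamma>'' t \<bullet> ?\<nu>) * s"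
          unfolding s_def .
        have curv: "\<gamma>'' t \<bullet> ?\<nu> = - ?H * s"
          using planar_mean_curvature[OF dim y[OF t] u \<nu>[unfolded \<gamma>_def]]
          by (simp add: s_def \<gamma>_def \<gamma>'_def \<gamma>''_def)
        have sq: "((\<lambda>t. sqrt (\<gamma>' t \<bullet> \<gamma>' t)) has_real_derivative (\<gamma>' t \<bullet> \<gamma>'' t) / sqrt s) (at t)"
          using DERIV_chain2[OF DERIV_real_sqrt[OF pos[OF t]] has_real_derivative_inner[OF D(2)[OF t] D(2)[OF t]]]
          by (simp add: s_def inner_commute field_simps)
        let ?c = "((\<gamma> t \<bullet> \<gamma>'' t + s) * sqrt s - (\<gamma> t \<bullet> \<gamma>' t) * ((\<gamma>' t \<bullet> \<gamma>'' t) / sqrt s)) / (sqrt s * sqrt s)"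
        have "(g has_real_derivative ?c) (at t)"
          unfolding g_def
          using DERIV_divide[OF has_real_derivative_inner[OF D[OF t]] sq] s by (simp add: s_def)
        moreover have "?c = sqrt s * (1 - ?H * (\<gamma> t \<bullet> ?\<nu>))"
        proof -
          \<comment> \<open>Clearing denominators, with \<open>k\<close> in the place of \<open>sqrt s\<close>.\<close>
          have alg: "((A + k * k) * k - a * (B / k)) / (k * k) * (k * k * k) = A * (k * k) + k * k * (k * k) - a * B"
            if "k \<noteq> 0" for A a B k :: real
            using that by (simp add: field_simps)
          have ss: "sqrt s * sqrt s = s" using s by simp
          have "?c * (s * sqrt s) = (\<gamma> t \<bullet> \<gamma>'' t) * s + s * s - (\<gamma> t \<bullet> \<gamma>' t) * (\<gamma>'' t \<bullet> \<gamma>' t)"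
            using alg[of "sqrt s" "\<gamma> t \<bullet> \<gamma>'' t" "\<gamma> t \<bullet> \<gamma>' t" "\<gamma>' t \<bullet> \<gamma>'' t"] s
            by (simp add: inner_commute[of "\<gamma>'' t" "\<gamma>' t"])
          also have "\<dots> = s * s * (1 - ?H * (\<gamma> t \<bullet> ?\<nu>))"
            unfolding frame curv by (simp add: algebra_simps)
          also have "\<dots> = s * (sqrt s * sqrt s) * (1 - ?H * (\<gamma> t \<bullet> ?\<nu>))"
            by (simp only: ss)
          also have "\<dots> = sqrt s * (1 - ?H * (\<gamma> t \<bullet> ?\<nu>)) * (s * sqrt s)"
            by (simp only: ac_simps)
          finally show ?thesis using s by simp
        qed
        moreover have "sqrt s * (1 - ?H * (\<gamma> t \<bullet> ?\<nu>)) \<ge> 0"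
          using le[OF \<gamma>M] s by simp
        ultimately show ?thesis by auto
      qed
      have "g 0 = 0"
      proof -
        have "\<gamma> 0 = q" using q by (simp add: \<gamma>_def \<psi>_\<phi>)
        moreover have "\<gamma>' 0 \<in> tangent_space M (\<gamma> 0)"
          unfolding \<gamma>_def \<gamma>'_def by (rule d\<psi>_in_tangent_space[OF y[of 0] u]) simp_all
        ultimately have "n q \<bullet> \<gamma>' 0 = 0" using n[OF q(1)] by (simp add: unit_normal_def)
        moreover have "q = (q \<bullet> n q) *\<^sub>R n q"
          by (rule farthest_point(1)[OF q n[OF q(1)] N max])
        ultimately have "q \<bullet> \<gamma>' 0 = 0" by (metis inner_scaleR_left mult_zero_right)
        then show ?thesis using \<open>\<gamma> 0 = q\<close> by (simp add: g_def)
      qed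
      have g_nonneg: "g t \<ge> 0" if t: "0 \<le> t" "t \<le> 1" for t
        using DERIV_nonneg_imp_nondecreasing[OF t(1), of g] g' t \<open>g 0 = 0\<close> by force
      have outward: "\<gamma> t \<bullet> \<gamma>' t \<ge> 0" if "0 \<le> t" "t \<le> 1" for t
      proof -
        have "\<gamma> t \<bullet> \<gamma>' t = g t * sqrt (\<gamma>' t \<bullet> \<gamma>' t)" using pos[OF that] by (simp add: g_def)
        then show ?thesis using g_nonneg[OF that] by simp
      qed
      have "\<exists>c. ((\<lambda>t. \<gamma> t \<bullet> \<gamma> t) has_real_derivative c) (at t) \<and> c \<ge> 0" if "0 \<le> t" "t \<le> 1" for t
      proof (intro exI conjI)
        show "((\<lambda>t. \<gamma> t \<bullet> \<gamma> t) has_real_derivative \<gamma> t \<bullet> \<gamma>' t + \<gamma>' t \<bullet> \<gamma> t) (at t)"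
          by (rule has_real_derivative_inner[OF D(1)[OF that] D(1)[OF that]])
        show "\<gamma> t \<bullet> \<gamma>' t + \<gamma>' t \<bullet> \<gamma> t \<ge> 0"
          using outward[OF that] by (simp add: inner_commute)
      qed
      then have "\<gamma> 0 \<bullet> \<gamma> 0 \<le> \<gamma> 1 \<bullet> \<gamma> 1"
        using DERIV_nonneg_imp_nondecreasing[of 0 1 "\<lambda>t. \<gamma> t \<bullet> \<gamma> t"] by simp
      moreover have "\<gamma> 0 = q" "\<gamma> 1 = x" using q z by (simp_all add: \<gamma>_def \<psi>_\<phi> u_def)
      ultimately have "norm q \<le> norm x" by (simp add: norm_le)
      moreover have "norm x \<le> norm q" using max x N'(3) by blast
      ultimately show ?thesis by simp
    qed
  qed
  with N' show ?thesis by blast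
qed

end

lemma slice_chart_exists:
  assumes "smooth_embedded_hypersurface M" "p \<in> M"
  obtains U V \<phi> \<psi> b where "slice_chart M U V \<phi> \<psi> b" "p \<in> U"
  using assms unfolding smooth_embedded_hypersurface_def slice_chart_def by metis

section \<open>Components and the final argument\<close>
lemma norm_constant_on_component:
  fixes M :: "'a::euclidean_space set" and n :: "'a \<Rightarrow> 'a"
  assumes dim: "DIM('a) = 2" and M: "smooth_embedded_hypersurface M" "compact M"
    and n: "\<And>x. x \<in> M \<Longrightarrow> unit_normal M x (n x)"
    and le: "\<And>x. x \<in> M \<Longrightarrow> mean_curvature M x (n x) * (x \<bullet> n x) \<le> 1"
    and x: "x \<in> M" "y \<in> connected_component_set M x"
  shows "norm y = norm x"
proof -
  let ?C = "connected_component_set M x"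
  have sub: "?C \<subseteq> M" by (rule connected_component_subset)
  have xC: "x \<in> ?C" using x(1) by simp
  have "compact ?C"
    using M(2) sub closed_connected_component[OF compact_imp_closed[OF M(2)]]
    by (metis compact_Int_closed inf.absorb_iff2)
  then obtain p where p: "p \<in> ?C" "\<And>z. z \<in> ?C \<Longrightarrow> norm z \<le> norm p"
    using continuous_attains_sup[of ?C norm] xC continuous_on_norm_id by blast
  define S where "S = {z \<in> ?C. norm z = norm p}"
  have "closedin (top_of_set ?C) S"
    unfolding S_def by (intro continuous_closedin_preimage_constant continuous_on_norm_id)
  moreover have "openin (top_of_set ?C) S"
  proof (subst openin_subopen, intro ballI)
    fix z assume z: "z \<in> S"
    then have zM: "z \<in> M" and zC: "z \<in> ?C" and zp: "norm z = norm p"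
      using sub by (auto simp: S_def)
    obtain U V \<phi> \<psi> b where "slice_chart M U V \<phi> \<psi> b" and zU: "z \<in> U"
      by (rule slice_chart_exists[OF M(1) zM])
    then interpret slice_chart M U V \<phi> \<psi> b by simp
    obtain N where N: "open N" "z \<in> N" "M \<inter> N \<subseteq> ?C"
      using component_neighbourhood[OF zM zU zC] by blast
    have "norm v \<le> norm z" if "v \<in> M" "v \<in> N" for v
      using p(2)[of v] N(3) that zp by auto
    then obtain N' where N': "open N'" "z \<in> N'" "\<forall>v\<in>M \<inter> N'. norm v = norm z"
      using planar_norm_locally_constant[OF dim zM zU n le N(1,2)] by blast
    have "openin (top_of_set ?C) (?C \<inter> N')" by (rule openin_open_Int[OF N'(1)])
    moreover have "z \<in> ?C \<inter> N'" using zC N'(2) by blast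
    moreover have "?C \<inter> N' \<subseteq> S" using N'(3) sub zp by (auto simp: S_def)
    ultimately show "\<exists>T. openin (top_of_set ?C) T \<and> z \<in> T \<and> T \<subseteq> S" by blast
  qed
  ultimately have "S = {} \<or> S = ?C"
    using connected_connected_component[of M x] unfolding connected_clopen by blast
  moreover have "p \<in> S" using p by (simp add: S_def)
  ultimately have "S = ?C" by blast
  then have "x \<in> S" "y \<in> S" using xC x(2) by simp_all
  then show ?thesis by (simp add: S_def)
qed

text \<open>
  If a point \<open>z\<close> of the sphere were missing from \<open>C\<close>, one could leave the open ball through \<open>z\<close>
  without meeting \<open>C\<close>, so nothing would be enclosed. In terms of open sets: any point of the sphere
  off \<open>C\<close> is a limit of points beyond the sphere, hence outside \<open>C\<close>; and \<open>z\<close> is also a limit of points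
  of the ball, which is connected and therefore outside as well.
\<close>
lemma closed_subset_sphere_eq:
  fixes C :: "'a::euclidean_space set"
  assumes C: "closed C" "C \<subseteq> sphere 0 R" and R: "R > 0" and ins: "inside C \<noteq> {}"
  shows "C = sphere 0 R"
proof (rule ccontr)
  assume "C \<noteq> sphere 0 R"
  then obtain z where z: "z \<in> sphere 0 R" "z \<notin> C" using C(2) by blast
  have ext: "- cball 0 R \<subseteq> outside C"
    using C(2) by (intro outside_subset_convex) auto
  have sph: "w \<in> outside C" if w: "w \<in> sphere 0 R" "w \<notin> C" for w
  proof (rule ccontr)
    assume "w \<notin> outside C"
    then have "w \<in> inside C" using w(2) by (simp add: inside_outside)
    moreover have "w \<in> closure (- cball 0 R)" using w(1) by (simp add: closure_complement)
    ultimately have "inside C \<inter> - cball 0 R \<noteq> {}"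
      using open_Int_closure_eq_empty[OF open_inside[OF C(1)]] by blast
    then show False using ext inside_Int_outside[of C] by blast
  qed
  have "z \<in> closure (ball 0 R)" using z(1) R by simp
  then have "outside C \<inter> ball 0 R \<noteq> {}"
    using open_Int_closure_eq_empty[OF open_outside[OF C(1)]] sph[OF z] by blast
  then obtain a where a: "a \<in> outside C" "a \<in> ball 0 R" by blast
  have "ball 0 R \<subseteq> - C" using C(2) by auto
  then have "w \<in> outside C" if "w \<in> ball 0 R" for w
    using outside_same_component[OF _ a(1)] that a(2) connected_ball[of 0 R]
    by (meson connected_component_def)
  moreover have "w \<in> ball 0 R \<or> w \<in> sphere 0 R \<or> w \<in> - cball 0 R" for w :: 'a
    by auto
  ultimately have "inside C \<subseteq> outside C"
    using ext sph inside_no_overlap[of C] by blast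
  then show False using ins inside_Int_outside[of C] by blast
qed

text \<open>
  The bounds place \<open>h\<close> between the roots \<open>(l - s) / 2 \<le> 0\<close> and \<open>(l + s) / 2\<close> of
  \<open>2 h (h - l) = 1\<close>, where \<open>s = sqrt (l\<^sup>2 + 2)\<close>, and \<open>m = 2 (h - l)\<close>.
\<close>
lemma curvature_times_support_le_1:
  fixes h m l :: real
  assumes "h - m / 2 = l" "0 \<le> h" "h \<le> (sqrt (l\<^sup>2 + 2) + l) / 2"
  shows "h * m \<le> 1"
proof -
  define s where "s = sqrt (l\<^sup>2 + 2)"
  have s: "s * s = l * l + 2" by (simp add: s_def power2_eq_square)
  have "\<bar>l\<bar> \<le> s" unfolding s_def by (rule real_le_rsqrt) simp
  then have "(h - (s + l) / 2) * (h + (s - l) / 2) \<le> 0"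
    using assms(2,3) by (intro mult_nonpos_nonneg) (auto simp: s_def)
  moreover have "(h - (s + l) / 2) * (h + (s - l) / 2) = h * (h - l) - (s * s - l * l) / 4"
    by (simp add: field_simps)
  ultimately have le: "h * (h - l) \<le> 1 / 2" using s by simp
  have "h * m = 2 * (h * (h - l))"
    unfolding assms(1)[symmetric] by simp
  also have "\<dots> \<le> 2 * (1 / 2)" by (rule mult_left_mono[OF le]) simp
  finally show ?thesis by simp
qed


theorem theorem1p3:
  fixes M :: "'a::euclidean_space set" and n :: "'a \<Rightarrow> 'a" and l :: real
  assumes "DIM('a) \<ge> 2"
    and "smooth_embedded_hypersurface M" and "compact M" and "M \<noteq> {}"
    and "\<And>x. x \<in> M \<Longrightarrow> is_outer_unit_normal M x (n x)"
    and "lambda_hypersurface l M n"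
    and "l \<le> 0"
    and "\<And>x. x \<in> M \<Longrightarrow>
           0 \<le> mean_curvature M x (n x) \<and>
           mean_curvature M x (n x) \<le> (sqrt (l\<^sup>2 + 2) + l) / 2"
  shows "\<exists>c r. r > 0 \<and> M = sphere c r"
proof -
  let ?H = "\<lambda>x. mean_curvature M x (n x)"
  have n: "unit_normal M x (n x)" if "x \<in> M" for x
    using assms(5)[OF that] by (simp add: is_outer_unit_normal_def unit_normal_def)
  have H: "?H x - (x \<bullet> n x) / 2 = l" "0 \<le> ?H x" if "x \<in> M" for x
    using assms(6) assms(8)[OF that] that by (auto simp: lambda_hypersurface_def)
  have le: "?H x * (x \<bullet> n x) \<le> 1" if "x \<in> M" for x
    using curvature_times_support_le_1[OF H[OF that]] assms(8)[OF that] by blast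
  \<comment> \<open>Beyond the plane, a farthest point from the origin contradicts \<open>le\<close>.\<close>
  have dim: "DIM('a) = 2"
  proof -
    obtain p where p: "p \<in> M" "\<And>x. x \<in> M \<Longrightarrow> norm x \<le> norm p"
      using continuous_attains_sup[OF assms(3,4) continuous_on_norm_id] by blast
    obtain U V \<phi> \<psi> b where "slice_chart M U V \<phi> \<psi> b" and pU: "p \<in> U"
      by (rule slice_chart_exists[OF assms(2) p(1)])
    then interpret slice_chart M U V \<phi> \<psi> b by simp
    have "real (DIM('a) - 1) \<le> 1"
      using farthest_point(2)[OF p(1) pU n[OF p(1)] open_UNIV UNIV_I p(2)] le[OF p(1)] by simp
    then show ?thesis using assms(1) by simp
  qed
  \<comment> \<open>As the norm is constant on components, every point is a local maximum of it.\<close>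
  have radius: "norm x > 0 \<and> 1 / norm x - norm x / 2 = l" if x: "x \<in> M" for x
  proof -
    obtain U V \<phi> \<psi> b where "slice_chart M U V \<phi> \<psi> b" and xU: "x \<in> U"
      by (rule slice_chart_exists[OF assms(2) x])
    then interpret slice_chart M U V \<phi> \<psi> b by simp
    have "x \<in> connected_component_set M x" using x by simp
    then obtain N where N: "open N" "x \<in> N" "M \<inter> N \<subseteq> connected_component_set M x"
      using component_neighbourhood[OF x xU] by blast
    then have max: "norm y \<le> norm x" if "y \<in> M" "y \<in> N" for y
      using norm_constant_on_component[OF dim assms(2,3) n le x, of y] that by auto
    note far = farthest_point[OF x xU n[OF x] N(1,2) max]
    have one: "?H x * (x \<bullet> n x) = 1" using far(2) le[OF x] dim by simp
    then have pos: "x \<bullet> n x > 0"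
      using H(2)[OF x] by (metis less_eq_real_def mult_nonneg_nonpos not_le zero_less_one)
    have "norm x = \<bar>x \<bullet> n x\<bar> * norm (n x)"
      using arg_cong[OF far(1), of norm] by simp
    then have "norm x = x \<bullet> n x" using pos n[OF x] by (simp add: unit_normal_def)
    moreover have "?H x = 1 / (x \<bullet> n x)" using one pos by (simp add: eq_divide_eq)
    ultimately show ?thesis using pos H(1)[OF x] by simp
  qed
  obtain x where x: "x \<in> M" using assms(4) by blast
  have same: "norm y = norm x" if "y \<in> M" for y
  proof -
    \<comment> \<open>The map \<open>r \<mapsto> 1 / r - r / 2\<close> is injective on positive reals.\<close>
    have "r = s" if "r > 0" "s > 0" "1 / r - r / 2 = 1 / s - s / 2" for r s :: real
    proof (rule ccontr)
      assume "r \<noteq> s"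
      have "(s - r) * (2 + r * s) = 0" using that by (simp add: field_simps)
      moreover have "2 + r * s > 0" using that by (simp add: add_pos_pos)
      ultimately show False using \<open>r \<noteq> s\<close> by simp
    qed
    then show ?thesis using radius[OF that] radius[OF x] by metis
  qed
  let ?C = "connected_component_set M x"
  have CM: "?C \<subseteq> M" by (rule connected_component_subset)
  have M_sphere: "M \<subseteq> sphere 0 (norm x)" using same by auto
  have "\<forall>\<^sub>F t in at_right (0::real). x - t *\<^sub>R n x \<in> inside ?C"
    using assms(5)[OF x] by (auto simp: is_outer_unit_normal_def Let_def elim: eventually_mono)
  then have "inside ?C \<noteq> {}"
    using eventually_happens'[OF trivial_limit_at_right_real] by blast
  moreover have "closed ?C" by (rule closed_connected_component[OF compact_imp_closed[OF assms(3)]])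
  ultimately have "?C = sphere 0 (norm x)"
    using CM M_sphere radius[OF x] by (intro closed_subset_sphere_eq) auto
  then have "M = sphere 0 (norm x)" using CM M_sphere by blast
  then show ?thesis using radius[OF x] by blast
qed

end
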